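(* Let $\mathbb{R}_{+}=[0,+\infty)$ and let $\mathbb{H}$ be the open upper half-plane. Suppose that $F:\mathbb{C}\setminus\mathbb{R}_{+}\to\mathbb{C}$ is analytic, $F(\mathbb{H})\subset\mathbb{H}$, $F((-\infty,0))\subset(-\infty,0)$, and $F(\overline{z})=\overline{F(z)}$ for every $z\in\mathbb{C}\setminus\mathbb{R}_{+}$. Then $F(\Omega_{\alpha})\subset\Omega_{\alpha}$ for every $\alpha\in(0,\pi)$, where $\Omega_{\alpha}=\{z\in\mathbb{C}\setminus\mathbb{R}_{+}:|\arg z|>\alpha\}$.
   Context: The argument takes values in $(-\pi,\pi]$, so that $(-\infty,0)\subset\Omega_\alpha$. *)

theory Defs
  imports "HOL-Complex_Analysis.Complex_Analysis"
begin

definition upper_half_plane :: "complex set" where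
  "upper_half_plane = {z. Im z > 0}"

text \<open>The set \<open>-\<real>\<^sub>\<ge>\<^sub>0\<close> is the complement of the closed ray in the complex plane; \<^const>\<open>Arg\<close> is the
  argument with values in \<open>(-\<pi>, \<pi>]\<close>, so it equals \<open>\<pi>\<close> on the negative real axis.\<close>

definition Omega :: "real \<Rightarrow> complex set" where
  "Omega \<alpha> = {z \<in> -\<real>\<^sub>\<ge>\<^sub>0. \<bar>Arg z\<bar> > \<alpha>}"

end

theory Submission
  imports Defs
begin

text \<open>
  Conjugation by \<open>z \<mapsto> csqrt (- z)\<close> turns \<open>F\<close> into a self-map \<open>g\<close> of the right half-plane that
  preserves the positive axis. By Schwarz--Pick, \<open>g\<close> does not increase the hyperbolic distance
  between \<open>w\<close> and \<open>\<bar>w\<bar>\<close>, the point of the axis nearest to \<open>w\<close>; since the distance to the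
  axis is an increasing function of \<open>\<bar>Arg w\<bar>\<close>, it follows that \<open>\<bar>Arg (g w)\<bar> \<le> \<bar>Arg w\<bar>\<close>.
\<close>

lemma norm_diff_less_norm_add_of_real:
  fixes z :: complex and s :: real
  assumes "Re z > 0" and "s > 0"
  shows "norm (z - of_real s) < norm (z + of_real s)"
proof -
  have "Re z * s > 0" using assms by simp
  then have "(norm (z - of_real s))\<^sup>2 < (norm (z + of_real s))\<^sup>2"
    unfolding cmod_power2 by (simp add: power2_eq_square algebra_simps)
  then show ?thesis
    by (rule power_less_imp_less_base) simp
qed

text \<open>Cayley maps carry the half-plane to the unit disc, with \<open>t\<close> and
  \<open>s\<close> going to 0; the Schwarz lemma then applies. Both sides are pseudo-hyperbolic
  distances to points of the axis.\<close>

lemma Schwarz_Pick_right_half_plane_real: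
  fixes g :: "complex \<Rightarrow> complex"
  assumes hol: "g holomorphic_on {w. Re w > 0}"
    and pos: "\<And>w. Re w > 0 \<Longrightarrow> Re (g w) > 0"
    and t: "t > 0" and s: "s > 0" and gt: "g (of_real t) = of_real s"
    and w: "Re w > 0"
  shows "norm ((g w - of_real s) / (g w + of_real s)) \<le> norm ((w - of_real t) / (w + of_real t))"
proof -
  \<comment> \<open>\<open>c\<close> is the inverse of the Cayley map
    \<open>(w - t) / (w + t)\<close>, so \<open>h\<close> is \<open>g\<close> transported to the
    disc, fixing 0.\<close>
  define c where "c \<zeta> = of_real t * (1 + \<zeta>) / (1 - \<zeta>)" for \<zeta> :: complex
  define h where "h \<zeta> = (g (c \<zeta>) - of_real s) / (g (c \<zeta>) + of_real s)" for \<zeta>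
  have ne: "1 - \<zeta> \<noteq> 0" if "\<zeta> \<in> ball 0 1" for \<zeta> :: complex
    using that by auto
  have Re_c: "Re (c \<zeta>) > 0" if "\<zeta> \<in> ball 0 1" for \<zeta>
  proof -
    have "(norm \<zeta>)\<^sup>2 < 1" using that by (simp add: abs_square_less_1)
    moreover have "c \<zeta> = of_real t * ((1 + \<zeta>) * cnj (1 - \<zeta>)) / of_real ((norm (1 - \<zeta>))\<^sup>2)"
      unfolding c_def using complex_div_cnj[of "of_real t * (1 + \<zeta>)" "1 - \<zeta>"] by (simp add: mult.assoc)
    then have "Re (c \<zeta>) = t * (1 - (norm \<zeta>)\<^sup>2) / (norm (1 - \<zeta>))\<^sup>2"
      unfolding cmod_power2[of \<zeta>]
      by (simp only: Re_divide_of_real) (simp add: power2_eq_square algebra_simps)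
    ultimately show ?thesis using t ne[OF that] by simp
  qed
  have ps: "g (c \<zeta>) + of_real s \<noteq> 0" if "\<zeta> \<in> ball 0 1" for \<zeta>
    using pos[OF Re_c[OF that]] s by (auto simp: complex_eq_iff)
  have "c holomorphic_on ball 0 1"
    unfolding c_def by (intro holomorphic_intros) (use ne in auto)
  then have gc: "(\<lambda>\<zeta>. g (c \<zeta>)) holomorphic_on ball 0 1"
    using holomorphic_on_compose_gen[OF _ hol, of c "ball 0 1"] Re_c
    by (simp add: o_def image_subset_iff)
  have hh: "h holomorphic_on ball 0 1"
    unfolding h_def by (intro holomorphic_intros gc) (use ps in auto)
  have h0: "h 0 = 0" by (simp add: h_def c_def gt)
  have h1: "norm (h \<zeta>) < 1" if "norm \<zeta> < 1" for \<zeta>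
    using norm_diff_less_norm_add_of_real[OF pos[OF Re_c] s, of \<zeta>] ps[of \<zeta>] that
    by (simp add: h_def norm_divide)
  define \<zeta> where "\<zeta> = (w - of_real t) / (w + of_real t)"
  have wt: "w + of_real t \<noteq> 0" using w t by (auto simp: complex_eq_iff)
  have z1: "norm \<zeta> < 1"
    using norm_diff_less_norm_add_of_real[OF w t] wt by (simp add: \<zeta>_def norm_divide)
  have "1 + \<zeta> = 2 * w / (w + of_real t)" "1 - \<zeta> = 2 * of_real t / (w + of_real t)"
    using wt by (simp_all add: \<zeta>_def divide_simps)
  then have "c \<zeta> = w" using wt t by (simp add: c_def)
  moreover have "norm (h \<zeta>) \<le> norm \<zeta>"
    using Schwarz_Lemma(1)[OF hh h0 h1 z1] .
  ultimately show ?thesis by (simp add: h_def \<zeta>_def)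
qed

text \<open>This is \<open>cos (Arg w) \<le> cos (Arg (g w))\<close> with denominators cleared:
  sectors around the positive axis are preserved.\<close>

lemma right_half_plane_self_map_sector:
  fixes g :: "complex \<Rightarrow> complex"
  assumes hol: "g holomorphic_on {w. Re w > 0}"
    and pos: "\<And>w. Re w > 0 \<Longrightarrow> Re (g w) > 0"
    and real: "\<And>t. t > 0 \<Longrightarrow> g (of_real t) \<in> \<real>"
    and w: "Re w > 0"
  shows "Re w * norm (g w) \<le> Re (g w) * norm w"
proof -
  \<comment> \<open>The axis point nearest to \<open>w\<close> in the hyperbolic metric.\<close>
  define t where "t = norm w"
  have t: "t > 0" using w by (auto simp: t_def)
  define s where "s = Re (g (of_real t))"
  have gt: "g (of_real t) = of_real s" using real[OF t] by (simp add: s_def)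
  have s: "s > 0" using pos[of "of_real t"] t by (simp add: s_def)
  define x a r where "x = Re w" and "a = Re (g w)" and "r = norm (g w)"
  have ne: "w + of_real t \<noteq> 0" "g w + of_real s \<noteq> 0"
    using w t pos[OF w] s by (auto simp: complex_eq_iff)
  have sq: "(norm (z - of_real b))\<^sup>2 = (norm z)\<^sup>2 + b\<^sup>2 - 2 * Re z * b"
    "(norm (z + of_real b))\<^sup>2 = (norm z)\<^sup>2 + b\<^sup>2 + 2 * Re z * b" for z b
    unfolding cmod_power2 by (simp_all add: power2_eq_square algebra_simps)
  have "norm (g w - of_real s) * norm (w + of_real t) \<le> norm (w - of_real t) * norm (g w + of_real s)"
    using Schwarz_Pick_right_half_plane_real[OF hol pos t s gt w] ne
    by (simp add: norm_divide divide_simps)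
  then have "(norm (g w - of_real s) * norm (w + of_real t))\<^sup>2
      \<le> (norm (w - of_real t) * norm (g w + of_real s))\<^sup>2"
    by (rule power_mono) simp
  then have "(r\<^sup>2 + s\<^sup>2 - 2 * a * s) * (t\<^sup>2 + t\<^sup>2 + 2 * x * t) \<le> (t\<^sup>2 + t\<^sup>2 - 2 * x * t) * (r\<^sup>2 + s\<^sup>2 + 2 * a * s)"
    by (simp only: power_mult_distrib sq flip: r_def a_def x_def t_def)
  \<comment> \<open>With A = \<open>r^2 + s^2\<close> and B = \<open>2 * t^2\<close>, the terms AB
    and \<open>4 * a * s * x * t\<close> cancel, leaving \<open>4 * x * t\<close> A \<le>
    \<open>4 * a * s\<close> B.\<close>
  then have "(4 * t) * (x * (r\<^sup>2 + s\<^sup>2)) \<le> (4 * t) * (2 * a * s * t)"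
    by (simp add: algebra_simps power2_eq_square)
  then have "x * (r\<^sup>2 + s\<^sup>2) \<le> 2 * a * s * t" using t by simp
  \<comment> \<open>The value \<open>s\<close> is unknown; the bound
    \<open>2 * r * s \<le> r^2 + s^2\<close> lets it be divided out.\<close>
  moreover have "x * (2 * r * s) \<le> x * (r\<^sup>2 + s\<^sup>2)"
    using w sum_squares_bound[of r s] by (intro mult_left_mono) (auto simp: x_def)
  ultimately have "(2 * s) * (x * r) \<le> (2 * s) * (a * t)" by (simp add: algebra_simps)
  then show ?thesis using s by (simp add: x_def a_def r_def t_def)
qed

text \<open>The map \<open>csqrt (- z)\<close> halves angles measured from the negative axis, so the
  sector estimate for \<open>g\<close> becomes one for \<open>F\<close>; the sign in
  \<open>- z\<close> reverses the inequality between cosines.\<close>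

lemma cos_Arg_le_cos_Arg:
  fixes F :: "complex \<Rightarrow> complex"
  assumes hol: "F holomorphic_on -\<real>\<^sub>\<ge>\<^sub>0"
    and slit: "\<And>z. z \<in> -\<real>\<^sub>\<ge>\<^sub>0 \<Longrightarrow> F z \<in> -\<real>\<^sub>\<ge>\<^sub>0"
    and neg: "\<And>x. x < 0 \<Longrightarrow> F (of_real x) \<in> \<real>"
    and z: "z \<in> -\<real>\<^sub>\<ge>\<^sub>0"
  shows "cos (Arg (F z)) \<le> cos (Arg z)"
proof -
  define g where "g w = csqrt (- F (- w\<^sup>2))" for w
  have csq: "Re (csqrt (- u)) > 0" if "u \<in> -\<real>\<^sub>\<ge>\<^sub>0" for u
  proof -
    define v where "v = csqrt (- u)"
    have "u = - v\<^sup>2" by (simp add: v_def)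
    \<comment> \<open>If \<open>v\<close> were purely imaginary or 0, then \<open>- v^2\<close>
      would lie on the removed ray.\<close>
    then have "Re v \<noteq> 0"
      using that by (auto simp: complex_nonneg_Reals_iff Re_power2 Im_power2)
    then show ?thesis using csqrt_principal[of "- u"] by (auto simp only: v_def)
  qed
  have dom: "- w\<^sup>2 \<in> -\<real>\<^sub>\<ge>\<^sub>0" if "Re w > 0" for w :: complex
    using that by (auto simp: complex_nonneg_Reals_iff Re_power2 Im_power2)
  have Fhol: "(\<lambda>w. F (- w\<^sup>2)) holomorphic_on {w. Re w > 0}"
    using holomorphic_on_compose_gen[of "\<lambda>w. - w\<^sup>2" "{w. Re w > 0}" F "-\<real>\<^sub>\<ge>\<^sub>0"] hol dom
    by (simp add: o_def image_subset_iff holomorphic_intros)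
  have ghol: "g holomorphic_on {w. Re w > 0}"
    unfolding g_def
  proof (rule holomorphic_on_csqrt')
    show "(\<lambda>w. - F (- w\<^sup>2)) holomorphic_on {w. Re w > 0}"
      by (intro holomorphic_intros Fhol)
    show "- F (- w\<^sup>2) \<notin> \<real>\<^sub>\<le>\<^sub>0" if "w \<in> {w. Re w > 0}" for w
      using slit[OF dom, of w] that by (simp add: complex_nonpos_Reals_iff complex_nonneg_Reals_iff)
  qed
  have gpos: "Re (g w) > 0" if "Re w > 0" for w
    unfolding g_def by (intro csq slit dom that)
  have greal: "g (of_real t) \<in> \<real>" if t: "t > 0" for t
  proof -
    have "F (- (of_real t)\<^sup>2) \<in> \<real>" using neg[of "- t\<^sup>2"] t by simp
    moreover have "F (- (of_real t)\<^sup>2) \<in> -\<real>\<^sub>\<ge>\<^sub>0" using t by (intro slit dom) simp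
    ultimately obtain y where "F (- (of_real t)\<^sup>2) = of_real y" "y < 0"
      by (force elim!: Reals_cases)
    then show ?thesis
      by (simp add: g_def flip: of_real_minus)
  qed
  define w where "w = csqrt (- z)"
  have w: "Re w > 0" unfolding w_def by (rule csq[OF z])
  have ww: "w\<^sup>2 = - z" and gg: "(g w)\<^sup>2 = - F z" by (simp_all add: w_def g_def)
  \<comment> \<open>The half-angle formula for the cosine, multiplied by
    \<open>norm (u^2)\<close>.\<close>
  have sq: "2 * (Re u)\<^sup>2 = Re (u\<^sup>2) + norm (u\<^sup>2)" for u
    by (simp add: norm_power cmod_power2 Re_power2)
  have "(Re w * norm (g w))\<^sup>2 \<le> (Re (g w) * norm w)\<^sup>2"
    using right_half_plane_self_map_sector[OF ghol gpos greal w] w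
    by (intro power_mono) auto
  then have "(2 * (Re w)\<^sup>2) * norm ((g w)\<^sup>2) \<le> (2 * (Re (g w))\<^sup>2) * norm (w\<^sup>2)"
    by (simp add: power_mult_distrib norm_power)
  \<comment> \<open>Here \<open>sq\<close> gives \<open>norm z - Re z\<close> and
    \<open>norm (F z) - Re (F z)\<close>; the product of the norms cancels.\<close>
  then have "Re (F z) * norm z \<le> Re z * norm (F z)"
    unfolding sq ww gg by (simp add: algebra_simps)
  moreover have "z \<noteq> 0" "F z \<noteq> 0" using z slit[OF z] by auto
  ultimately show ?thesis by (simp add: cos_Arg divide_simps)
qed

theorem lemma2p3:
  fixes F :: "complex \<Rightarrow> complex"
  assumes "F analytic_on -\<real>\<^sub>\<ge>\<^sub>0"
    and "F ` upper_half_plane \<subseteq> upper_half_plane"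
    and "F ` (complex_of_real ` {..<0}) \<subseteq> complex_of_real ` {..<0}"
    and "\<And>z. z \<in> -\<real>\<^sub>\<ge>\<^sub>0 \<Longrightarrow> F (cnj z) = cnj (F z)"
  shows "\<forall>\<alpha>\<in>{0<..<pi}. F ` Omega \<alpha> \<subseteq> Omega \<alpha>"
proof -
  have up: "Im (F z) > 0" if "Im z > 0" for z
    using assms(2) that by (auto simp: upper_half_plane_def)
  have neg: "\<exists>y<0. F (of_real x) = of_real y" if "x < 0" for x
    using assms(3) that by (force simp: image_subset_iff)
  \<comment> \<open>The lower half-plane is handled by reflection, the negative axis and the upper
    half-plane by hypothesis.\<close>
  have slit: "F z \<in> -\<real>\<^sub>\<ge>\<^sub>0" if z: "z \<in> -\<real>\<^sub>\<ge>\<^sub>0" for z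
  proof (cases "Im z" "0 :: real" rule: linorder_cases)
    case less
    then have "Im (F z) < 0" using up[of "cnj z"] assms(4)[OF z] by simp
    then show ?thesis by (simp add: complex_nonneg_Reals_iff)
  next
    case equal
    then have "z = of_real (Re z)" "Re z < 0"
      using z by (auto simp: complex_eq_iff complex_nonneg_Reals_iff)
    then obtain y where "y < 0" "F z = of_real y" using neg by metis
    then show ?thesis by (simp add: complex_nonneg_Reals_iff)
  next
    case greater
    then show ?thesis using up[of z] by (simp add: complex_nonneg_Reals_iff)
  qed
  have Arg_le: "\<bar>Arg z\<bar> \<le> \<bar>Arg (F z)\<bar>" if z: "z \<in> -\<real>\<^sub>\<ge>\<^sub>0" for z
  proof -
    have "cos (Arg (F z)) \<le> cos (Arg z)"
    proof (rule cos_Arg_le_cos_Arg[OF analytic_imp_holomorphic[OF assms(1)] slit _ z])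
      show "F (of_real x) \<in> \<real>" if "x < 0" for x
        using neg[OF that] by auto
    qed
    moreover have "\<bar>Arg u\<bar> \<le> pi" for u
      using Arg_bounded[of u] by auto
    \<comment> \<open>Cosine is even and decreasing on \<open>[0, pi]\<close>, so the comparison of
      cosines reverses for absolute values.\<close>
    ultimately show ?thesis
      using cos_mono_le_eq[of "\<bar>Arg (F z)\<bar>" "\<bar>Arg z\<bar>"] by simp
  qed
  show ?thesis
    using slit Arg_le by (fastforce simp: Omega_def)
qed

end
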